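(* Let $D$ be a unique factorization domain. The following properties are equivalent: (1) $D$ is a $D$-ring; (2) $D$ satisfies the infinite primes property (IPP); (3) $D$ satisfies the degree polynomial property (DPP); (4) $D$ satisfies the evaluation polynomial property (EPP); (5) $D$ satisfies the strong evaluation polynomial property (SEPP).
   Context: "Domain" means (commutative) integral domain; fields are allowed, and a field is a UFD with no primes. Convention: $\deg 0=-\infty$. "For almost all $k\in D$" means for all but finitely many $k\in D$. Definitions, for a domain $D$ with quotient field $K$ (a UFD in the case of EPP and SEPP): - $D$ is a $D$-ring if for all $f(x),g(x)\in D[x]$ with $g\neq 0$: if $g(k)\mid f(k)$ in $D$ for almost all $k\in D$, then $\frac{f(x)}{g(x)}\in K[x]$. - $D$ satisfies IPP if for every $g(x)\in D[x]$ with $\deg g\ge 1$ the set $\{p\in P : (\exists k\in D)(g(k)\neq 0 \text{ and } p\mid g(k))\}$ is infinite, where $P$ is the set of prime elements of $D$. - $D$ satisfies DPP if for all $f(x),g(x)\in D[x]$: if for all $k\in D$ ($g(k)\neq 0\Rightarrow g(k)\mid f(k)$), then $f(x)=0$ or $\deg f(x)\ge \deg g(x)$. - $D$ satisfies EPP if for all $f(x),g(x)\in D[x]$ with $g(x)$ primitive and $\deg g\ge 1$: if for all $k\in D$ ($g(k)\ne 0\Rightarrow g(k)\mid f(k)$), then $g(x)\mid f(x)$ in $D[x]$. - $D$ satisfies SEPP if for each $g(x)\in D[x]$ irreducible with $\deg g\ge 1$ there exists an infinite set $I_{g(x)}\subseteq D$ such that for each $f(x)\in D[x]$ and each infinite $H\subseteq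 I_{g(x)}$: if for all $k\in H$ ($g(k)\neq 0\Rightarrow g(k)\mid f(k)$), then $g(x)\mid f(x)$ in $D[x]$. *)

theory Defs
  imports "Berlekamp_Zassenhaus.Unique_Factorization_Poly"
begin

text \<open>
  A domain $D$ is a type of class \<^class>\<open>idom\<close>, a unique factorization domain a type of class
  \<^class>\<open>ufd\<close>; the properties of $D$ are predicates on the type.
  The quotient field $K$ of $D$ is \<^typ>\<open>'a fract\<close>.
\<close>

text \<open>
  For $g \neq 0$, the quotient $f/g$ lies in $K[x]$ iff the image of $g$ in $K[x]$ divides the
  image of $f$.
\<close>

definition D_ring :: "'a::idom itself \<Rightarrow> bool" where
  "D_ring _ \<longleftrightarrow>
    (\<forall>f g :: 'a poly. g \<noteq> 0 \<longrightarrow> finite {k. \<not> poly g k dvd poly f k} \<longrightarrow>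
       map_poly to_fract g dvd map_poly to_fract f)"

text \<open>
  Prime elements are counted as elements of $D$, not up to associates.
\<close>

definition IPP :: "'a::idom itself \<Rightarrow> bool" where
  "IPP _ \<longleftrightarrow>
    (\<forall>g :: 'a poly. degree g \<ge> 1 \<longrightarrow>
       infinite {p. prime_elem p \<and> (\<exists>k. poly g k \<noteq> 0 \<and> p dvd poly g k)})"

text \<open>
  The convention $\deg 0 = -\infty$ matters here only for $g = 0$, where the conclusion holds for
  every $f$; with \<^term>\<open>degree 0 = (0 :: nat)\<close> it holds as well.
\<close>

definition DPP :: "'a::idom itself \<Rightarrow> bool" where
  "DPP _ \<longleftrightarrow>
    (\<forall>f g :: 'a poly. (\<forall>k. poly g k \<noteq> 0 \<longrightarrow> poly g k dvd poly f k) \<longrightarrow>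
       f = 0 \<or> degree f \<ge> degree g)"

definition EPP :: "'a::ufd itself \<Rightarrow> bool" where
  "EPP _ \<longleftrightarrow>
    (\<forall>f g :: 'a poly. primitive_poly g \<longrightarrow> degree g \<ge> 1 \<longrightarrow>
       (\<forall>k. poly g k \<noteq> 0 \<longrightarrow> poly g k dvd poly f k) \<longrightarrow> g dvd f)"

definition SEPP :: "'a::ufd itself \<Rightarrow> bool" where
  "SEPP _ \<longleftrightarrow>
    (\<forall>g :: 'a poly. irreducible g \<longrightarrow> degree g \<ge> 1 \<longrightarrow>
       (\<exists>I :: 'a set. infinite I \<and>
          (\<forall>f H. infinite H \<longrightarrow> H \<subseteq> I \<longrightarrow>
             (\<forall>k\<in>H. poly g k \<noteq> 0 \<longrightarrow> poly g k dvd poly f k) \<longrightarrow> g dvd f)))"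

end

theory Submission
  imports Defs
begin

text \<open>
  Each of the five properties is equivalent to the following one: a polynomial over $D$ all of
  whose nonzero values are units is constant.

  Suppose first that this fails for some nonconstant $g$. No prime divides a nonzero value of $g$,
  so IPP fails. Let $h$ be a nonconstant irreducible factor of $g$. The values of $h$ away from
  the finitely many roots of $g$ are units, so all nonzero values of $h$ divide the product $c$ of
  the nonzero values that $h$ takes at the roots of $g$. Thus the constant polynomial $f = c$
  together with $h$ refutes each of the other four properties.

  Suppose conversely that the property holds. The substitution
  $g(a + g(a) c x) = g(a) (1 + c x q(x))$, where $g(a) \neq 0$, produces a nonconstant polynomial
  $1 + c x q(x)$, which has a nonzero nonunit value. A prime factor of that value divides a value
  of $g$ but not $c$ (\<open>new_prime_in_values\<close>). Euclid's argument now gives IPP, and no $c \neq 0$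
  is a multiple of all nonzero values of a nonconstant polynomial. For the $D$-ring property, a
  Bezout identity with denominators cleared (\<open>bezout_without_denominators\<close>) replaces $f$ and $g$ by
  polynomials $f_1$ and $g_1$ that are coprime over the quotient field $K$. The value $g_1(k)$
  then divides $f_1(k)$ for almost all $k$, hence also a fixed nonzero constant, which forces
  $g_1$ to be constant; that is, $g$ divides $f$ in $K[x]$. DPP follows by comparing degrees, EPP by
  Gauss's lemma.

  For SEPP, the new primes are chosen one after another, each dividing a value $g(k_n)$ but none of
  the earlier values. A nonzero constant has finitely many prime factors up to associates, so it
  is a multiple of only finitely many $g(k_n)$. This finiteness survives the passage to an
  infinite subset of $\{k_n\}$, and the same Bezout argument applies.
\<close>

definition unit_valued :: "'a::idom poly \<Rightarrow> bool" where
  "unit_valued g \<longleftrightarrow> (\<forall>k. poly g k \<noteq> 0 \<longrightarrow> poly g k dvd 1)"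

definition unit_valued_imp_const :: "'a::idom itself \<Rightarrow> bool" where
  "unit_valued_imp_const _ \<longleftrightarrow> (\<forall>g :: 'a poly. unit_valued g \<longrightarrow> degree g = 0)"


section \<open>Irreducible factors and primitive polynomials\<close>

lemma ex_prime_divisor:
  fixes x :: "'a::ufd"
  assumes "x \<noteq> 0" "\<not> x dvd 1"
  obtains p where "prime_elem p" "p dvd x"
proof -
  obtain F where F: "mset_factors F x"
    using mset_factors_exist[OF assms] by blast
  then obtain p where p: "p \<in># F"
    using mset_factorsD(2)[OF F] by blast
  show ?thesis
  proof (rule that)
    show "prime_elem p"
      using mset_factorsD(1)[OF F p] by (simp only: prime_elem_iff_irreducible)
    show "p dvd x" by (rule mset_factors_imp_dvd[OF F p])
  qed
qed

lemma degree_prod_mset_0: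
  fixes F :: "'a::idom poly multiset"
  shows "(\<And>q. q \<in># F \<Longrightarrow> degree q = 0) \<Longrightarrow> degree (prod_mset F) = 0"
proof (induction F)
  case (add q F)
  have "degree (q * prod_mset F) \<le> degree q + degree (prod_mset F)"
    by (rule degree_mult_le)
  with add show ?case by simp
qed simp

lemma ex_nonconst_irreducible_factor:
  fixes g :: "'a::ufd poly"
  assumes "degree g \<ge> 1"
  obtains h where "irreducible h" "degree h \<ge> 1" "h dvd g"
proof -
  have "g \<noteq> 0" using assms by auto
  moreover have "\<not> g dvd 1" using assms divides_degree[of g 1] by auto
  ultimately obtain F where F: "mset_factors F g"
    using mset_factors_exist by blast
  have "\<exists>q. q \<in># F \<and> degree q \<noteq> 0"
    using degree_prod_mset_0[of F] mset_factorsD(3)[OF F] assms by force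
  then obtain q where q: "q \<in># F" "degree q \<noteq> 0" by blast
  show ?thesis
    by (rule that[of q]) (use q mset_factorsD(1)[OF F] mset_factors_imp_dvd[OF F] in auto)
qed

lemma irreducible_imp_primitive_poly:
  fixes g :: "'a::idom poly"
  assumes irr: "irreducible g" and deg: "degree g \<ge> 1"
  shows "primitive_poly g"
  unfolding primitive_poly_def
proof (intro allI impI)
  fix d assume d: "\<forall>i. d dvd coeff g i"
  then have "[:d:] dvd g" by (simp add: const_poly_dvd_iff)
  then have "g dvd [:d:] \<or> [:d:] dvd 1"
    using irr unfolding irreducible_altdef by blast
  moreover have False if dvd: "g dvd [:d:]"
  proof -
    have "d \<noteq> 0"
      using d deg by (metis dvd_0_left_iff leading_coeff_0_iff degree_0 not_one_le_zero)
    then show False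
      using divides_degree[OF dvd] deg by simp
  qed
  ultimately have "[:d:] dvd 1" by blast
  then show "d dvd 1" by simp
qed

text \<open>
  By Gauss's lemma, divisibility in $D[x]$ is divisibility in $K[x]$ together with divisibility of
  contents; the content of a primitive polynomial is a unit.
\<close>

lemma primitive_dvd_iff_dvd_fract:
  fixes f g :: "'a::ufd poly"
  assumes "primitive_poly g"
  shows "g dvd f \<longleftrightarrow> map_poly to_fract g dvd map_poly to_fract f"
proof -
  obtain c where c: "content_ff (map_poly to_fract g) = to_fract c"
    using content_ff_map_poly_to_fract[of g] by auto
  have "c dvd coeff g i" for i
  proof (cases "coeff g i = 0")
    case False
    then have "coeff (map_poly to_fract g) i \<in> set (coeffs (map_poly to_fract g))"
      using coeff_in_coeffs[of "map_poly to_fract g" i] le_degree[of g i] by force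
    then have "divides_ff (to_fract c) (coeff (map_poly to_fract g) i)"
      using content_ff_divides_ff c by metis
    then show ?thesis by simp
  qed simp
  then have "c dvd 1"
    using assms unfolding primitive_poly_def by blast
  obtain b where b: "content_ff (map_poly to_fract f) = to_fract b"
    using content_ff_map_poly_to_fract[of f] by auto
  have "divides_ff (to_fract c) (to_fract b)"
    using \<open>c dvd 1\<close> by (metis divides_ff_to_fract dvd_trans one_dvd)
  then show ?thesis
    unfolding dvd_PM_iff[of g f] c b by simp
qed


section \<open>A Bezout identity without denominators\<close>

text \<open>
  The polynomial $d$ plays the role of the greatest common divisor over the quotient field: it is a
  nonzero element of least degree in the ideal generated by $f$ and $g$. Pseudo-division by $d$ leaves
  a remainder in this ideal, which vanishes by minimality.
\<close>

lemma bezout_without_denominators: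
  fixes f g :: "'a::idom poly"
  assumes g: "g \<noteq> 0"
  obtains c d f1 g1 u v where "c \<noteq> 0" "d \<noteq> 0"
    "smult c f = d * f1" "smult c g = d * g1" "u * f1 + v * g1 = [:c:]"
proof -
  define J where "J = {d. d \<noteq> 0 \<and> (\<exists>u v. d = u * f + v * g)}"
  have "g = 0 * f + 1 * g" by simp
  then have "g \<in> J" unfolding J_def using g by blast
  then obtain d where dJ: "d \<in> J" and least: "\<And>e. e \<in> J \<Longrightarrow> degree d \<le> degree e"
    using ex_has_least_nat[of "\<lambda>d. d \<in> J" g degree] by blast
  from dJ obtain u v where d0: "d \<noteq> 0" and duv: "d = u * f + v * g"
    unfolding J_def by blast
  have quot: "\<exists>a q. a \<noteq> 0 \<and> smult a h = d * q" if h: "h = u' * f + v' * g" for h u' v'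
  proof -
    obtain a q where a: "a \<noteq> 0" and eq: "smult a h = d * q + pseudo_mod h d"
      using pseudo_mod(1)[OF d0, of h] by blast
    have "pseudo_mod h d = smult a h - d * q" using eq by simp
    also have "\<dots> = ([:a:] * u' - u * q) * f + ([:a:] * v' - v * q) * g"
      unfolding h by (subst duv) (simp add: algebra_simps smult_add_right)
    finally have "pseudo_mod h d = 0"
      using pseudo_mod(2)[OF d0, of h] least unfolding J_def
      by (metis (mono_tags, lifting) leD mem_Collect_eq)
    with a eq show ?thesis by auto
  qed
  obtain a p where a: "a \<noteq> 0" "smult a f = d * p"
    using quot[of f 1 0] by auto
  obtain b q where b: "b \<noteq> 0" "smult b g = d * q"
    using quot[of g 0 1] by auto
  have f1: "smult (a * b) f = d * smult b p"
    using arg_cong[OF a(2), of "smult b"] by (simp add: mult.commute)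
  have g1: "smult (a * b) g = d * smult a q"
    using arg_cong[OF b(2), of "smult a"] by simp
  \<comment> \<open>Multiplying the identity for \<open>d\<close> by \<open>a * b\<close> makes \<open>d\<close> a factor of both sides.\<close>
  have "d * (u * smult b p + v * smult a q) = u * (d * smult b p) + v * (d * smult a q)"
    by (simp add: algebra_simps)
  also have "\<dots> = smult (a * b) d"
    unfolding f1[symmetric] g1[symmetric] by (subst duv) (simp add: algebra_simps smult_add_right)
  also have "\<dots> = d * [:a * b:]" by simp
  finally have "u * smult b p + v * smult a q = [:a * b:]"
    using d0 mult_left_cancel by blast
  with f1 g1 show ?thesis
    using a(1) b(1) d0 by (intro that[of "a * b" d "smult b p" "smult a q" u v]) auto
qed

text \<open>
  After cancellation of $d(k)$ the value $g_1(k)$ divides $f_1(k)$, and hence the Bezout combination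
  of the two.
\<close>

lemma values_dvd_const:
  fixes f g :: "'a::idom poly"
  assumes "c \<noteq> 0" "smult c f = d * f1" "smult c g = d * g1" "u * f1 + v * g1 = [:c:]"
    and k: "poly d k \<noteq> 0" "poly g k dvd poly f k"
  shows "poly g1 k dvd c"
proof -
  have "poly (smult c g) k dvd poly (smult c f) k" using k(2) by simp
  then have "poly d k * poly g1 k dvd poly d k * poly f1 k"
    unfolding assms(2,3) by simp
  then have "poly g1 k dvd poly f1 k" using k(1) by simp
  then have "poly g1 k dvd poly (u * f1 + v * g1) k" by simp
  then show ?thesis unfolding assms(4) by simp
qed

text \<open>
  If $g_1$ is the constant $e$, then cancelling $c d$ in $c d e f = d g_1 \cdot c f = c g \cdot d f_1$
  gives $e f = g f_1$, and $e$ is a unit of the quotient field.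
\<close>

lemma dvd_fract_if_cofactor_const:
  fixes f g :: "'a::idom poly"
  assumes c: "c \<noteq> 0" and d: "d \<noteq> 0" and g: "g \<noteq> 0"
    and f1: "smult c f = d * f1" and g1: "smult c g = d * g1" and deg: "degree g1 = 0"
  shows "map_poly to_fract g dvd map_poly to_fract f"
proof -
  interpret map_poly_inj_idom_hom to_fract ..
  obtain e where e: "g1 = [:e:]" using degree0_coeffs[OF deg] by auto
  have e0: "e \<noteq> 0" using g1 e c g by auto
  have "d * smult c (smult e f) = smult e (d * smult c f)"
    by (simp add: mult.commute[of e c])
  also have "\<dots> = d * (d * smult e f1)" unfolding f1 by simp
  also have "\<dots> = d * (smult c g * f1)" unfolding g1 e by simp
  finally have "d * smult c (smult e f) = d * smult c (g * f1)" by simp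
  then have "smult c (smult e f) = smult c (g * f1)"
    using d mult_left_cancel by blast
  then have "smult e f = g * f1" using c by (metis smult_cancel)
  then have "smult (to_fract e) (map_poly to_fract f) = map_poly to_fract g * map_poly to_fract f1"
    by (metis to_fract_hom.map_poly_hom_smult hom_mult)
  then have "map_poly to_fract g dvd smult (to_fract e) (map_poly to_fract f)" by simp
  then show ?thesis using e0 by (simp add: dvd_smult_iff)
qed


section \<open>Primes dividing the values of a polynomial\<close>

text \<open>
  Expanding $g(a + y) = b + y\,q(y)$ with $b = g(a) \neq 0$ and substituting $y = b c x$ gives
  $b\,(1 + c x\,q(b c x))$. The second factor is nonconstant, and all its values are
  congruent to $1$ modulo $c$.
\<close>

lemma new_prime_in_values:
  fixes g :: "'a::ufd poly"
  assumes U: "unit_valued_imp_const TYPE('a)" and deg: "degree g \<ge> 1" and c: "c \<noteq> 0"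
  obtains k p where "poly g k \<noteq> 0" "prime_elem p" "p dvd poly g k" "\<not> p dvd c"
proof -
  have "\<not> unit_valued g"
    using U[unfolded unit_valued_imp_const_def, rule_format, of g] deg by auto
  then obtain a where a: "poly g a \<noteq> 0"
    unfolding unit_valued_def by blast
  define b where "b = poly g a"
  obtain b' q where q: "pcompose g [:a, 1:] = pCons b' q" by (cases "pcompose g [:a, 1:]")
  have "b' = poly (pcompose g [:a, 1:]) 0" unfolding q by simp
  then have b': "b' = b" unfolding b_def by (simp add: poly_pcompose)
  have b0: "b \<noteq> 0" using a b_def by simp
  have "degree (pCons b' q) = degree g"
    unfolding q[symmetric] by (simp add: degree_pcompose)
  then have q0: "q \<noteq> 0" using deg by auto
  define G where "G = pCons 1 (smult c (pcompose q [:0, b * c:]))"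
  have val: "b * poly G y = poly g (a + b * c * y)" for y
  proof -
    have "poly g (a + b * c * y) = poly (pcompose g [:a, 1:]) (b * c * y)"
      by (simp add: poly_pcompose)
    also have "\<dots> = b * poly G y"
      unfolding q b' G_def by (simp add: poly_pcompose algebra_simps)
    finally show ?thesis by simp
  qed
  have "pcompose q [:0, b * c:] \<noteq> 0"
    using q0 b0 c by (simp add: pcompose_eq_0_iff)
  then have "degree G \<noteq> 0" unfolding G_def using c by simp
  then have "\<not> unit_valued G"
    using U[unfolded unit_valued_imp_const_def, rule_format, of G] by auto
  then obtain y where y: "poly G y \<noteq> 0" "\<not> poly G y dvd 1"
    unfolding unit_valued_def by blast
  obtain p where p: "prime_elem p" "p dvd poly G y"
    by (rule ex_prime_divisor[OF y])
  have "\<not> p dvd c"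
  proof
    assume "p dvd c"
    then have "p dvd y * (c * poly (pcompose q [:0, b * c:]) y)" by simp
    with p(2) have "p dvd 1"
      unfolding G_def by (simp add: dvd_add_left_iff)
    with prime_elem_not_unit[OF p(1)] show False by contradiction
  qed
  moreover have "poly g (a + b * c * y) \<noteq> 0" "p dvd poly g (a + b * c * y)"
    unfolding val[symmetric] using b0 y p by auto
  ultimately show ?thesis by (intro that[OF _ p(1)])
qed

lemma values_not_all_dvd_const:
  fixes g :: "'a::ufd poly"
  assumes "unit_valued_imp_const TYPE('a)" "degree g \<ge> 1" "c \<noteq> 0"
  shows "\<exists>k. poly g k \<noteq> 0 \<and> \<not> poly g k dvd c"
  using new_prime_in_values[OF assms] dvd_trans by metis

text \<open>
  Every prime factor of $c$ divides one of the finitely many members of a factorization of $c$, and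
  two primes that divide the same irreducible element are associated.
\<close>

lemma finite_nonassociated_prime_divisors:
  fixes p :: "'i \<Rightarrow> 'a::ufd"
  assumes prime: "\<And>i. prime_elem (p i)" and nonassoc: "\<And>i j. p i dvd p j \<Longrightarrow> i = j"
    and c: "c \<noteq> 0"
  shows "finite {i. p i dvd c}"
proof (cases "c dvd 1")
  case True
  then have "{i. p i dvd c} = {}"
    using prime_elem_not_unit[OF prime] by (auto dest: dvd_trans)
  then show ?thesis by simp
next
  case False
  then obtain F where F: "mset_factors F c"
    using mset_factors_exist c by blast
  have "\<exists>q\<in>#F. p i dvd q \<and> q dvd p i" if "p i dvd c" for i
    using irreducible_dvd_imp_factor[OF that prime_elem_imp_irreducible[OF prime] F] .
  then obtain q where q: "\<And>i. p i dvd c \<Longrightarrow> q i \<in># F \<and> p i dvd q i \<and> q i dvd p i" by metis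
  have "inj_on q {i. p i dvd c}"
  proof (rule inj_onI)
    fix i j assume ij: "i \<in> {i. p i dvd c}" "j \<in> {i. p i dvd c}" "q i = q j"
    then have "p i dvd p j" using q[of i] q[of j] dvd_trans by auto
    then show "i = j" by (rule nonassoc)
  qed
  moreover have "q ` {i. p i dvd c} \<subseteq> set_mset F" using q by auto
  ultimately show ?thesis
    using finite_subset finite_imageD finite_set_mset by metis
qed

text \<open>
  The state of the recursion is a triple: a common multiple $c$ of all earlier values, the new
  argument $k$, and a prime factor of $g(k)$ that does not divide $c$.
\<close>

lemma ex_infinite_set_values_rarely_dvd:
  fixes g :: "'a::ufd poly"
  assumes U: "unit_valued_imp_const TYPE('a)" and deg: "degree g \<ge> 1"
  obtains I where "infinite I" "\<And>k. k \<in> I \<Longrightarrow> poly g k \<noteq> 0"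
    "\<And>c. c \<noteq> 0 \<Longrightarrow> finite {k \<in> I. poly g k dvd c}"
proof -
  define P where "P = (\<lambda>(n::nat) (c, k, p). c \<noteq> 0 \<and> poly g k \<noteq> 0 \<and> prime_elem p \<and>
    p dvd poly g k \<and> \<not> p dvd c)"
  define Q where "Q = (\<lambda>(n::nat) (c, k, p::'a) (c', k'::'a, p'::'a). c' = c * poly g k)"
  have ext: "\<exists>k p. P n (c, k, p)" if "c \<noteq> 0" for n c
    by (rule new_prime_in_values[OF U deg that]) (use that in \<open>auto simp: P_def\<close>)
  have "\<exists>s. \<forall>n. P n (s n) \<and> Q n (s n) (s (Suc n))"
  proof (rule dependent_nat_choice)
    show "\<exists>x. P 0 x" using ext[of 1] by fastforce
  next
    fix x n assume Pn: "P n x"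
    obtain c k p where x: "x = (c, k, p)" by (cases x)
    with Pn have "c * poly g k \<noteq> 0" by (auto simp: P_def)
    with ext[of _ "Suc n"] show "\<exists>y. P (Suc n) y \<and> Q n x y"
      unfolding x Q_def by fastforce
  qed
  then obtain s where s: "\<And>n. P n (s n)" "\<And>n. Q n (s n) (s (Suc n))" by blast
  define C where "C n = fst (s n)" for n
  define \<kappa> where "\<kappa> n = fst (snd (s n))" for n
  define p where "p n = snd (snd (s n))" for n
  have s_eq: "s n = (C n, \<kappa> n, p n)" for n by (simp add: C_def \<kappa>_def p_def)
  have nz: "poly g (\<kappa> n) \<noteq> 0" and prime: "prime_elem (p n)" and pdvd: "p n dvd poly g (\<kappa> n)"
    and new: "\<not> p n dvd C n" for n
    using s(1)[of n] unfolding s_eq P_def by auto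
  have C_Suc: "C (Suc n) = C n * poly g (\<kappa> n)" for n
    using s(2)[of n] unfolding s_eq Q_def by simp
  have earlier: "i < n \<Longrightarrow> poly g (\<kappa> i) dvd C n" for i n
    by (induction n) (auto simp: C_Suc less_Suc_eq)
  have new_less: "\<not> p n dvd poly g (\<kappa> i)" if "i < n" for i n
    using earlier[OF that] new dvd_trans by blast
  have "inj \<kappa>"
    by (rule linorder_injI) (metis new_less pdvd)
  have nonassoc: "i = j" if "p i dvd p j" for i j
  proof (rule ccontr)
    assume "i \<noteq> j"
    have "p j dvd p i"
      using that prime by (metis irreducible_altdef prime_elem_iff_irreducible prime_elem_not_unit)
    with that \<open>i \<noteq> j\<close> show False
      using new_less pdvd by (metis dvd_trans linorder_neqE_nat)
  qed
  show ?thesis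
  proof (rule that[of "range \<kappa>"])
    show "infinite (range \<kappa>)" using \<open>inj \<kappa>\<close> range_inj_infinite by blast
    show "\<And>k. k \<in> range \<kappa> \<Longrightarrow> poly g k \<noteq> 0" using nz by blast
    fix c :: 'a assume "c \<noteq> 0"
    then have "finite (\<kappa> ` {n. p n dvd c})"
      using finite_nonassociated_prime_divisors[of p c] prime nonassoc by blast
    moreover have "{k \<in> range \<kappa>. poly g k dvd c} \<subseteq> \<kappa> ` {n. p n dvd c}"
      using pdvd dvd_trans by blast
    ultimately show "finite {k \<in> range \<kappa>. poly g k dvd c}"
      by (rule rev_finite_subset)
  qed
qed


section \<open>Consequences of the constancy of unit-valued polynomials\<close>

lemma unit_valued_imp_const_IPP:
  assumes U: "unit_valued_imp_const TYPE('a::ufd)"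
  shows "IPP TYPE('a)"
  unfolding IPP_def
proof (intro allI impI notI)
  fix g :: "'a poly"
  let ?P = "{p. prime_elem p \<and> (\<exists>k. poly g k \<noteq> 0 \<and> p dvd poly g k)}"
  assume deg: "degree g \<ge> 1" and fin: "finite ?P"
  have "\<Prod>?P \<noteq> 0" using fin by (auto simp: prime_elem_def)
  then obtain k p where p: "poly g k \<noteq> 0" "prime_elem p" "p dvd poly g k"
    and new: "\<not> p dvd \<Prod>?P"
    by (rule new_prime_in_values[OF U deg])
  from p have "p \<in> ?P" by auto
  from dvd_prodI[OF fin this, of "\<lambda>p. p"] new show False by contradiction
qed

text \<open>
  A nonconstant $g_1$ would have all its nonzero values among the divisors of one constant: the
  Bezout constant $c$ takes care of all but finitely many arguments, and the values at the
  remaining ones are multiplied into it.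
\<close>

lemma unit_valued_imp_const_D_ring:
  assumes U: "unit_valued_imp_const TYPE('a::ufd)"
  shows "D_ring TYPE('a)"
  unfolding D_ring_def
proof (intro allI impI)
  fix f g :: "'a poly"
  assume g: "g \<noteq> 0" and fin: "finite {k. \<not> poly g k dvd poly f k}"
  obtain c d f1 g1 u v where bez: "c \<noteq> 0" "d \<noteq> 0" "smult c f = d * f1" "smult c g = d * g1"
    "u * f1 + v * g1 = [:c:]"
    by (rule bezout_without_denominators[OF g])
  define E where "E = {k. (poly d k = 0 \<or> \<not> poly g k dvd poly f k) \<and> poly g1 k \<noteq> 0}"
  have "finite E"
    by (rule finite_subset[of _ "{k. poly d k = 0} \<union> {k. \<not> poly g k dvd poly f k}"])
      (use fin poly_roots_finite[OF bez(2)] in \<open>auto simp: E_def\<close>)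
  define e where "e = c * (\<Prod>k\<in>E. poly g1 k)"
  have "e \<noteq> 0" unfolding e_def using bez(1) \<open>finite E\<close> by (auto simp: E_def)
  have all: "poly g1 k dvd e" if "poly g1 k \<noteq> 0" for k
  proof (cases "k \<in> E")
    case True
    then show ?thesis unfolding e_def using \<open>finite E\<close> by (simp add: dvd_prodI)
  next
    case False
    then have "poly g1 k dvd c"
      using values_dvd_const[OF bez(1,3-5)] that unfolding E_def by blast
    then show ?thesis unfolding e_def by simp
  qed
  have "degree g1 = 0"
  proof (rule ccontr)
    assume "degree g1 \<noteq> 0"
    then have "degree g1 \<ge> 1" by simp
    from values_not_all_dvd_const[OF U this \<open>e \<noteq> 0\<close>] all show False by blast
  qed
  then show "map_poly to_fract g dvd map_poly to_fract f"
    using dvd_fract_if_cofactor_const bez(1-4) g by blast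
qed

lemma D_ring_dvd_if_values_dvd:
  fixes f g :: "'a::idom poly"
  assumes "D_ring TYPE('a)" and g: "g \<noteq> 0" and dvd: "\<forall>k. poly g k \<noteq> 0 \<longrightarrow> poly g k dvd poly f k"
  shows "map_poly to_fract g dvd map_poly to_fract f"
proof -
  have "finite {k. \<not> poly g k dvd poly f k}"
    by (rule finite_subset[OF _ poly_roots_finite[OF g]]) (use dvd in auto)
  then show ?thesis using assms(1) g unfolding D_ring_def by blast
qed

lemma D_ring_imp_DPP:
  assumes D: "D_ring TYPE('a::idom)"
  shows "DPP TYPE('a)"
  unfolding DPP_def
proof (intro allI impI)
  fix f g :: "'a poly"
  assume dvd: "\<forall>k. poly g k \<noteq> 0 \<longrightarrow> poly g k dvd poly f k"
  show "f = 0 \<or> degree f \<ge> degree g"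
  proof (cases "g = 0")
    case False
    from divides_degree[OF D_ring_dvd_if_values_dvd[OF D False dvd]] show ?thesis
      by auto
  qed simp
qed

lemma D_ring_imp_EPP:
  assumes D: "D_ring TYPE('a::ufd)"
  shows "EPP TYPE('a)"
  unfolding EPP_def
proof (intro allI impI)
  fix f g :: "'a poly"
  assume prim: "primitive_poly g" and deg: "degree g \<ge> 1"
    and dvd: "\<forall>k. poly g k \<noteq> 0 \<longrightarrow> poly g k dvd poly f k"
  from deg have "g \<noteq> 0" by auto
  from D_ring_dvd_if_values_dvd[OF D this dvd] show "g dvd f"
    unfolding primitive_dvd_iff_dvd_fract[OF prim] .
qed

text \<open>
  Since $g$ is prime in $D[x]$ and divides $c g = d g_1$, it divides $d$ or $g_1$. In the first case
  $g_1$ is constant, and $g$ divides $f$. In the second case $d$ is constant, so that $g(k)$ divides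
  the Bezout constant $c$ for all $k \in H$; but only finitely many $k \in I$ have this property.
\<close>

lemma unit_valued_imp_const_SEPP:
  assumes U: "unit_valued_imp_const TYPE('a::ufd)"
  shows "SEPP TYPE('a)"
  unfolding SEPP_def
proof (intro allI impI)
  fix g :: "'a poly"
  assume irr: "irreducible g" and deg: "degree g \<ge> 1"
  obtain I where I: "infinite I" "\<And>k. k \<in> I \<Longrightarrow> poly g k \<noteq> 0"
    "\<And>c. c \<noteq> 0 \<Longrightarrow> finite {k \<in> I. poly g k dvd c}"
    by (rule ex_infinite_set_values_rarely_dvd[OF U deg]) blast
  have "g dvd f" if H: "infinite H" "H \<subseteq> I"
    and dvd: "\<forall>k\<in>H. poly g k \<noteq> 0 \<longrightarrow> poly g k dvd poly f k" for f H
  proof -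
    have g0: "g \<noteq> 0" using deg by auto
    obtain c d f1 g1 u v where bez: "c \<noteq> 0" "d \<noteq> 0" "smult c f = d * f1" "smult c g = d * g1"
      "u * f1 + v * g1 = [:c:]"
      by (rule bezout_without_denominators[OF g0])
    have g1: "g1 \<noteq> 0" using bez(1,4) g0 by auto
    have deg_sum: "degree g = degree d + degree g1"
      using arg_cong[OF bez(4), of degree] bez(1,2) g1 by (simp add: degree_mult_eq)
    have "g dvd smult c g" by (simp add: dvd_smult)
    then have "g dvd d * g1" unfolding bez(4) .
    then have "g dvd d \<or> g dvd g1"
      using irr by (intro prime_elem_dvd_multD) (simp_all only: prime_elem_iff_irreducible)
    moreover have "\<not> g dvd g1"
    proof
      assume gg1: "g dvd g1"
      then have "degree g \<le> degree g1" using divides_degree g1 by blast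
      then have "degree d = 0" using deg_sum by simp
      then obtain e where e: "d = [:e:]" using degree0_coeffs by blast
      have "poly g k dvd c" if "k \<in> H" for k
      proof -
        have "poly g k dvd poly f k" using that dvd I(2) H(2) by blast
        moreover have "poly d k \<noteq> 0" using bez(2) e by simp
        ultimately have "poly g1 k dvd c" using values_dvd_const[OF bez(1,3-5)] by blast
        then show ?thesis using gg1 by (metis dvd_def dvd_mult_left poly_mult)
      qed
      then have "H \<subseteq> {k \<in> I. poly g k dvd c}" using H(2) by blast
      then show False using I(3)[OF bez(1)] H(1) finite_subset by blast
    qed
    ultimately have "degree g \<le> degree d" using divides_degree bez(2) by blast
    then have "degree g1 = 0" using deg_sum by simp
    then have "map_poly to_fract g dvd map_poly to_fract f"
      using dvd_fract_if_cofactor_const bez(1-4) g0 by blast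
    then show ?thesis
      using primitive_dvd_iff_dvd_fract[OF irreducible_imp_primitive_poly[OF irr deg]] by blast
  qed
  then show "\<exists>I. infinite I \<and> (\<forall>f H. infinite H \<longrightarrow> H \<subseteq> I \<longrightarrow>
      (\<forall>k\<in>H. poly g k \<noteq> 0 \<longrightarrow> poly g k dvd poly f k) \<longrightarrow> g dvd f)"
    using I(1) by blast
qed


section \<open>Nonconstant unit-valued polynomials as counterexamples\<close>

text \<open>
  Passing to an irreducible factor is needed because EPP concerns primitive and SEPP irreducible
  polynomials. A factor need not be unit-valued itself: at a root of $g$ its value may be a nonzero
  nonunit.
  The constant $c$ collects these finitely many values.
\<close>

lemma irreducible_values_dvd_const_if_not_unit_valued_imp_const:
  assumes "\<not> unit_valued_imp_const TYPE('a::ufd)"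
  obtains h :: "'a::ufd poly" and c :: 'a where "irreducible h" "degree h \<ge> 1" "c \<noteq> 0"
    "\<And>k. poly h k \<noteq> 0 \<Longrightarrow> poly h k dvd c"
proof -
  obtain g :: "'a poly" where g: "unit_valued g" "degree g \<ge> 1"
    using assms unfolding unit_valued_imp_const_def by (metis less_one linorder_not_less)
  obtain h where h: "irreducible h" "degree h \<ge> 1" "h dvd g"
    by (rule ex_nonconst_irreducible_factor[OF g(2)])
  have "g \<noteq> 0" using g(2) by auto
  define R where "R = {k. poly g k = 0 \<and> poly h k \<noteq> 0}"
  have fin: "finite R"
    by (rule finite_subset[OF _ poly_roots_finite[OF \<open>g \<noteq> 0\<close>]]) (auto simp: R_def)
  define c where "c = (\<Prod>k\<in>R. poly h k)"
  have "c \<noteq> 0" unfolding c_def using fin by (auto simp: R_def)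
  moreover have "poly h k dvd c" if "poly h k \<noteq> 0" for k
  proof (cases "poly g k = 0")
    case True
    then have "k \<in> R" using that by (simp add: R_def)
    then show ?thesis unfolding c_def using fin by (simp add: dvd_prodI)
  next
    case False
    then have "poly g k dvd 1" using g(1) unfolding unit_valued_def by blast
    moreover have "poly h k dvd poly g k" using h(3) by (auto simp: dvd_def)
    ultimately show ?thesis by (meson dvd_trans one_dvd)
  qed
  ultimately show ?thesis using that h by blast
qed

lemma not_dvd_const_poly:
  fixes h :: "'a::idom poly"
  assumes "degree h \<ge> 1" "c \<noteq> 0"
  shows "\<not> h dvd [:c:]"
  using divides_degree[of h "[:c:]"] assms by auto

lemma D_ring_imp_unit_valued_imp_const:
  assumes D: "D_ring TYPE('a::ufd)"
  shows "unit_valued_imp_const TYPE('a)"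
proof (rule ccontr)
  assume "\<not> ?thesis"
  then obtain h :: "'a poly" and c where h: "irreducible h" "degree h \<ge> 1" "c \<noteq> 0"
    and dvd: "\<And>k. poly h k \<noteq> 0 \<Longrightarrow> poly h k dvd c"
    by (rule irreducible_values_dvd_const_if_not_unit_valued_imp_const) blast
  have "h dvd [:c:]"
    unfolding primitive_dvd_iff_dvd_fract[OF irreducible_imp_primitive_poly[OF h(1,2)]]
    by (rule D_ring_dvd_if_values_dvd[OF D]) (use h dvd in auto)
  then show False using not_dvd_const_poly h by blast
qed

lemma IPP_imp_unit_valued_imp_const:
  assumes "IPP TYPE('a::idom)"
  shows "unit_valued_imp_const TYPE('a)"
  unfolding unit_valued_imp_const_def
proof (intro allI impI, rule ccontr)
  fix g :: "'a poly"
  assume g: "unit_valued g" "degree g \<noteq> 0"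
  have no_prime: "\<not> p dvd poly g k" if "prime_elem p" "poly g k \<noteq> 0" for p k
    using prime_elem_not_unit[OF that(1)] that(2) g(1) dvd_trans unfolding unit_valued_def by blast
  then have "{p. prime_elem p \<and> (\<exists>k. poly g k \<noteq> 0 \<and> p dvd poly g k)} = {}"
    by auto
  moreover have "infinite {p. prime_elem p \<and> (\<exists>k. poly g k \<noteq> 0 \<and> p dvd poly g k)}"
    using assms g(2) unfolding IPP_def by simp
  ultimately show False by (metis finite.emptyI)
qed

lemma DPP_imp_unit_valued_imp_const:
  assumes "DPP TYPE('a::idom)"
  shows "unit_valued_imp_const TYPE('a)"
  unfolding unit_valued_imp_const_def
proof (intro allI impI)
  fix g :: "'a poly"
  assume "unit_valued g"
  then have "\<forall>k. poly g k \<noteq> 0 \<longrightarrow> poly g k dvd poly 1 k"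
    unfolding unit_valued_def by simp
  then have "(1 :: 'a poly) = 0 \<or> degree (1 :: 'a poly) \<ge> degree g"
    using assms unfolding DPP_def by blast
  then show "degree g = 0" by simp
qed

lemma EPP_imp_unit_valued_imp_const:
  assumes E: "EPP TYPE('a::ufd)"
  shows "unit_valued_imp_const TYPE('a)"
proof (rule ccontr)
  assume "\<not> ?thesis"
  then obtain h :: "'a poly" and c where h: "irreducible h" "degree h \<ge> 1" "c \<noteq> 0"
    and dvd: "\<And>k. poly h k \<noteq> 0 \<Longrightarrow> poly h k dvd c"
    by (rule irreducible_values_dvd_const_if_not_unit_valued_imp_const) blast
  have "\<forall>k. poly h k \<noteq> 0 \<longrightarrow> poly h k dvd poly [:c:] k" using dvd by simp
  then have "h dvd [:c:]"
    using E irreducible_imp_primitive_poly[OF h(1,2)] h(2) unfolding EPP_def by blast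
  then show False using not_dvd_const_poly h by blast
qed

lemma SEPP_imp_unit_valued_imp_const:
  assumes S: "SEPP TYPE('a::ufd)"
  shows "unit_valued_imp_const TYPE('a)"
proof (rule ccontr)
  assume "\<not> ?thesis"
  then obtain h :: "'a poly" and c where h: "irreducible h" "degree h \<ge> 1" "c \<noteq> 0"
    and dvd: "\<And>k. poly h k \<noteq> 0 \<Longrightarrow> poly h k dvd c"
    by (rule irreducible_values_dvd_const_if_not_unit_valued_imp_const) blast
  obtain I :: "'a set" where "infinite I" and I: "\<And>f H. infinite H \<Longrightarrow> H \<subseteq> I \<Longrightarrow>
      (\<forall>k\<in>H. poly h k \<noteq> 0 \<longrightarrow> poly h k dvd poly f k) \<Longrightarrow> h dvd f"
    using S h(1,2) unfolding SEPP_def by meson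
  have "h dvd [:c:]" using I[of I "[:c:]"] \<open>infinite I\<close> dvd by simp
  then show False using not_dvd_const_poly h by blast
qed


section \<open>The equivalence\<close>

theorem theorem3p1:
  shows "(D_ring TYPE('a::ufd) \<longleftrightarrow> IPP TYPE('a)) \<and>
         (IPP TYPE('a) \<longleftrightarrow> DPP TYPE('a)) \<and>
         (DPP TYPE('a) \<longleftrightarrow> EPP TYPE('a)) \<and>
         (EPP TYPE('a) \<longleftrightarrow> SEPP TYPE('a))"
proof -
  let ?U = "unit_valued_imp_const TYPE('a)"
  have "D_ring TYPE('a) \<longleftrightarrow> ?U"
    using D_ring_imp_unit_valued_imp_const unit_valued_imp_const_D_ring by blast
  moreover have "IPP TYPE('a) \<longleftrightarrow> ?U"
    using IPP_imp_unit_valued_imp_const unit_valued_imp_const_IPP by blast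
  moreover have "DPP TYPE('a) \<longleftrightarrow> ?U"
    using DPP_imp_unit_valued_imp_const unit_valued_imp_const_D_ring D_ring_imp_DPP by blast
  moreover have "EPP TYPE('a) \<longleftrightarrow> ?U"
    using EPP_imp_unit_valued_imp_const unit_valued_imp_const_D_ring D_ring_imp_EPP by blast
  moreover have "SEPP TYPE('a) \<longleftrightarrow> ?U"
    using SEPP_imp_unit_valued_imp_const unit_valued_imp_const_SEPP by blast
  ultimately show ?thesis by blast
qed

end
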